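(* Consider a regular, possibly discontinuous, mechanical Hamiltonian system with smooth potential whose nonholonomic constraints $C_\pm$ (and whose instantaneous constraints along the critical hypersurface $N$, if there are any) are linear, i.e. given by vector subbundles. Then the Transition Principle always implies a loss of energy as the result of an impact: if a trajectory reaches the critical hypersurface at an $\varepsilon$-out point $y\in C_\varepsilon\cap T^*_NM$, $\varepsilon\in\{+,-\}$, then for every $(y,\varepsilon)$-decisive point $(y',\varepsilon')$, in the elastic mode as well as in the inelastic mode, and both when the Hamiltonian is smooth and when it is discontinuous along $N$, one has $$H_{\varepsilon'}(y')\le H_{\varepsilon}(y).$$
   Context: **Setting.** $M$ is a smooth manifold, $N\subset M$ a hypersurface dividing $M$ into $M_+$ and $M_-$ with $M_+\cup M_-=M$ and $M_+\cap M_-=N$ (common boundary). $\pi:T^*M\to M$ is the projection and $T^*_NM=\pi^{-1}(N)$. For each sign, $g_\pm$ is a Riemannian metric on $M_\pm$, $\mathcal G_\pm$ is the induced co-metric on $T^*M_\pm$, $V\in C^\infty(M)$, and $H_\pm(q,p)=\hat T_\pm(q,p)+V(q)$ with $\hat T_\pm(q,p)=\frac12\mathcal G_\pm(p,p)$. The Hamiltonian is called smooth if $g_\pm$ are the restrictions of one smooth metric $g$ on $M$ (so $H_\pm=H$), otherwise discontinuous along $N$. $\alpha_{H_\pm}:T^*M_\pm\to TM_\pm$, $(q,p)\mapsto(q,\partial H_\pm/\partial p)$, is the isomorphism induced by $\mathcal G_\pm$. $C_\pm\subset T^*M_\pm$ are vector subbundles (linear constraints) and $\mathcal D_\pm=\alpha_{H_\pm}(C_\pm)$.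 Regularity (transversality) means $\mathcal D_{\pm,q}\not\subset T_qN$ for $q\in N$. There may be instantaneous constraints along $N$: vector subbundles $C^{\rm inst}_\pm\subset C_\pm\cap T^*_NM$ over $N$. Set $C^{\rm tr}_\varepsilon=C_\varepsilon\cap\alpha_{H_\varepsilon}^{-1}(TN)$ and $C^{\rm inst,tr}_\varepsilon=C^{\rm inst}_\varepsilon\cap\alpha_{H_\varepsilon}^{-1}(TN)$. The sign opposite to $\varepsilon$ is written $\bar\varepsilon$. **Dynamics, in/out/trapping points.** $X_{H_\varepsilon,C_\varepsilon}$ is the unique vector field on $C_\varepsilon$ of the form $X_{H_\varepsilon}+R$, where $X_{H_\varepsilon}$ is the free Hamiltonian vector field and $R$ is vertical with values in the annihilator $\mathrm{Ann}(\mathcal D_\varepsilon)$ (under the identification of vertical vectors with covectors). The boundary of $C_\varepsilon$ is $C_\varepsilon\cap T^*_NM$. A boundary point $z$ is an $\varepsilon$-in point if there is a trajectory $\beta:[0,a]\to C_\varepsilon$, $a>0$, of $X_{H_\varepsilon,C_\varepsilon}$ with $\beta(0)=z$ and $\beta(t)$ not in the boundary for $0<t\le a$; it is an $\varepsilon$-out point if the same holds for $-X_{H_\varepsilon,C_\varepsilon}$; it is an $\varepsilon$-trapping point if it lies on a trajectory of $X_{H_\varepsilon,C_\varepsilon}$ entirely contained in the boundary. **Focusing points.** For a sign $\varepsilon$ and a linear constraint subbundle $E$ equal to $C_\varepsilon$, $C_\varepsilon^{\rm inst}$, $C_\varepsilon^{\rm tr}$ or $C_\varepsilon^{\rm inst,tr}$,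 the (unique) focusing point of $u\in T_q^*M$, $q\in N$, with respect to $E$ is the $\mathcal G_\varepsilon$-orthogonal projection of $u$ onto $E_q$. **Characteristics.** For $y\in C_\varepsilon\cap T_q^*M$, $q\in N$, the constrained characteristic is $\zeta_y(H_\varepsilon,C_\varepsilon)=y+\big(C_{\varepsilon,q}\cap\mathrm{Ann}(\mathcal D_{\varepsilon,q}\cap T_qN)\big)$, a line in $C_{\varepsilon,q}$. **Decisive points** of an $\varepsilon$-out point $y$: (1) *Elastic mode, smooth Hamiltonian, change of constraints.* A sequence $(y_i,\varepsilon_i)$, $0\le i\le k$, is admissible if $(y_0,\varepsilon_0)=(y,\varepsilon)$; $\varepsilon_{i+1}=\bar\varepsilon_i$; $y_{i+1}$ is the focusing point of $y_i$ with respect to $C^{\rm inst}_{\varepsilon_{i+1}}$ (or $C_{\varepsilon_{i+1}}$ if instantaneous constraints are absent); $y_i$ is an $\varepsilon_i$-out point for $i<k$; and $y_k$ is an $\varepsilon_k$-in or $\varepsilon_k$-trapping point. The end points $(y_k,\varepsilon_k)$ of admissible sequences are the $(y,\varepsilon)$-decisive points. (2) *Elastic mode, discontinuous Hamiltonian.* A reflective step goes from $(y,\varepsilon)$ to $(u,\varepsilon)$, where $z\in\zeta_y(H_\varepsilon,C_\varepsilon)$ satisfies $H_\varepsilon(z)=H_\varepsilon(y)$ and $u$ is the focusing point of $z$ with respect to $C^{\rm inst}_\varepsilon$ (or $C_\varepsilon$ if there are no $\varepsilon$-instantaneous constraints). A refractive step goes from $(y,\varepsilon)$ to $(u,\bar\varepsilon)$,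 where $z\in\zeta_y(H_\varepsilon,C_\varepsilon)$ satisfies $H_{\bar\varepsilon}(z)=H_\varepsilon(y)$ and $u$ is the focusing point of $z$ with respect to $C^{\rm inst}_{\bar\varepsilon}$ (or $C_{\bar\varepsilon}$). A sequence $(y_i,\varepsilon_i)$, $0\le i\le k$, is admissible if it starts at $(y,\varepsilon)$, consecutive terms are initial and end points of a reflective or refractive step, $y_i$ is an $\varepsilon_i$-out point for $i<k$, and $y_k$ is an $\varepsilon_k$-in or $\varepsilon_k$-trapping point. Its end point is $(y,\varepsilon)$-decisive. (3) *Inelastic mode, smooth Hamiltonian.* The decisive point is $(u,\bar\varepsilon)$ with $u$ the focusing point of $y$ with respect to $C^{\rm inst,tr}_{\bar\varepsilon}$ (or $C^{\rm tr}_{\bar\varepsilon}$ if instantaneous constraints are absent). (4) *Inelastic mode, discontinuous Hamiltonian.* The decisive points are the end points of one reflected falling step or one refracted falling step; these are defined as the reflective and refractive steps in (2), with $C^{\rm inst}$ replaced by $C^{\rm inst,tr}$ and $C$ replaced by $C^{\rm tr}$ (for the same sign) in the second move. Systems with boundary are included by setting $M_-=\emptyset$, $M_+=M$, $N=\partial M$, $H_-=\infty$, so that only reflective (falling) steps occur. The Transition Principle states that a trajectory reaching $T^*_NM$ at an $\varepsilon$-out point $y$ continues from any $(y,\varepsilon)$-decisive point, according to the chosen mode. *)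

theory Defs
  imports "HOL-Analysis.Analysis" "HOL-Library.Function_Algebras"
begin

primrec Ck_on :: "nat \<Rightarrow> ('a::euclidean_space \<Rightarrow> 'b::real_normed_vector) \<Rightarrow> 'a set \<Rightarrow> bool" where
  "Ck_on 0 f U \<longleftrightarrow> continuous_on U f"
| "Ck_on (Suc k) f U \<longleftrightarrow>
    (\<exists>f'. (\<forall>x\<in>U. (f has_derivative f' x) (at x)) \<and> (\<forall>v. Ck_on k (\<lambda>x. f' x v) U))"

text \<open>On an arbitrary set, smoothness means local smooth extendability to open sets, so that it
  makes sense up to the boundary of a half space and along submanifolds.\<close>

definition smooth_on :: "'a::euclidean_space set \<Rightarrow> ('a \<Rightarrow> 'b::real_normed_vector) \<Rightarrow> bool" where
  "smooth_on T f \<longleftrightarrow>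
    (\<forall>x\<in>T. \<exists>U F. open U \<and> x \<in> U \<and> (\<forall>k. Ck_on k F U) \<and> (\<forall>y\<in>T \<inter> U. F y = f y))"

text \<open>A chart is a pair of its domain and its coordinate map, with values in a Euclidean space whose
  dimension is that of the manifold. An atlas is not required to be maximal.\<close>

type_synonym ('m, 'e) chart = "'m set \<times> ('m \<Rightarrow> 'e)"

abbreviation chart_inv :: "('m, 'e) chart \<Rightarrow> 'e \<Rightarrow> 'm" where
  "chart_inv c \<equiv> inv_into (fst c) (snd c)"

definition half_open :: "'e::euclidean_space set \<Rightarrow> bool" where
  "half_open W \<longleftrightarrow> open W \<or> (\<exists>i\<in>Basis. openin (top_of_set {x. 0 \<le> x \<bullet> i}) W)"

definition smooth_atlas :: "'m topology \<Rightarrow> ('m, 'e::euclidean_space) chart set \<Rightarrow> bool" where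
  "smooth_atlas X A \<longleftrightarrow>
    (\<Union>c\<in>A. fst c) = topspace X \<and>
    (\<forall>c\<in>A. openin X (fst c) \<and> half_open (snd c ` fst c) \<and>
      homeomorphic_map (subtopology X (fst c)) (top_of_set (snd c ` fst c)) (snd c)) \<and>
    (\<forall>c\<in>A. \<forall>d\<in>A. smooth_on (snd c ` (fst c \<inter> fst d)) (snd d \<circ> chart_inv c))"

definition smooth_manifold :: "'m topology \<Rightarrow> ('m, 'e::euclidean_space) chart set \<Rightarrow> bool" where
  "smooth_manifold X A \<longleftrightarrow> Hausdorff_space X \<and> second_countable X \<and> smooth_atlas X A"

definition manifold_boundary :: "('m, 'e::euclidean_space) chart set \<Rightarrow> 'm set" where
  "manifold_boundary A = {q. \<exists>c\<in>A. q \<in> fst c \<and> snd c q \<notin> interior (snd c ` fst c)}"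

definition smooth_fun_on ::
    "('m, 'e::euclidean_space) chart set \<Rightarrow> 'm set \<Rightarrow> ('m \<Rightarrow> real) \<Rightarrow> bool" where
  "smooth_fun_on A T f \<longleftrightarrow> (\<forall>c\<in>A. smooth_on (snd c ` (fst c \<inter> T)) (f \<circ> chart_inv c))"

instantiation "fun" :: (type, real_vector) real_vector
begin

definition "scaleR r f = (\<lambda>x. r *\<^sub>R f x)" for f :: "'a \<Rightarrow> 'b"

instance
  by standard (simp_all add: scaleR_fun_def fun_eq_iff scaleR_add_right scaleR_add_left)

end

text \<open>A tangent vector at a point is the family of its components in all charts around that point
  (and \<open>0\<close> for all other arguments), which transform by the derivative of the coordinate change; the
  components of a covector transform contragrediently, where the dual of the coordinate space is
  identified with the coordinate space by the standard inner product.\<close>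

type_synonym ('m, 'e) tvector = "('m, 'e) chart \<Rightarrow> 'e"
type_synonym ('m, 'e) covector = "('m, 'e) chart \<Rightarrow> 'e"

definition dtrans ::
    "('m, 'e::euclidean_space) chart \<Rightarrow> ('m, 'e) chart \<Rightarrow> 'm \<Rightarrow> 'e \<Rightarrow> 'e" where
  "dtrans c d q =
    frechet_derivative (snd d \<circ> chart_inv c) (at (snd c q) within snd c ` (fst c \<inter> fst d))"

definition charts_at :: "('m, 'e) chart set \<Rightarrow> 'm \<Rightarrow> ('m, 'e) chart set" where
  "charts_at A q = {c \<in> A. q \<in> fst c}"

definition tangent :: "('m, 'e::euclidean_space) chart set \<Rightarrow> 'm \<Rightarrow> ('m, 'e) tvector set" where
  "tangent A q = {v. (\<forall>c. c \<notin> charts_at A q \<longrightarrow> v c = 0) \<and>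
    (\<forall>c\<in>charts_at A q. \<forall>d\<in>charts_at A q. v d = dtrans c d q (v c))}"

definition cotangent :: "('m, 'e::euclidean_space) chart set \<Rightarrow> 'm \<Rightarrow> ('m, 'e) covector set" where
  "cotangent A q = {\<xi>. (\<forall>c. c \<notin> charts_at A q \<longrightarrow> \<xi> c = 0) \<and>
    (\<forall>c\<in>charts_at A q. \<forall>d\<in>charts_at A q. \<forall>x. \<xi> c \<bullet> x = \<xi> d \<bullet> dtrans c d q x)}"

text \<open>The evaluation of a covector on a tangent vector does not depend on the chosen chart.\<close>

definition pairing ::
    "('m, 'e::euclidean_space) chart set \<Rightarrow> 'm \<Rightarrow> ('m, 'e) covector \<Rightarrow> ('m, 'e) tvector \<Rightarrow> real" where
  "pairing A q \<xi> v = (let c = (SOME c. c \<in> charts_at A q) in \<xi> c \<bullet> v c)"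

definition annihilator ::
    "('m, 'e::euclidean_space) chart set \<Rightarrow> 'm \<Rightarrow> ('m, 'e) tvector set \<Rightarrow> ('m, 'e) covector set" where
  "annihilator A q D = {\<xi> \<in> cotangent A q. \<forall>v\<in>D. pairing A q \<xi> v = 0}"

definition coord_vector ::
    "('m, 'e::euclidean_space) chart set \<Rightarrow> ('m, 'e) chart \<Rightarrow> 'm \<Rightarrow> 'e \<Rightarrow> ('m, 'e) tvector" where
  "coord_vector A c q x = (THE v. v \<in> tangent A q \<and> v c = x)"

definition has_velocity ::
    "('m, 'e::euclidean_space) chart set \<Rightarrow> (real \<Rightarrow> 'm) \<Rightarrow> real \<Rightarrow> real set \<Rightarrow> ('m, 'e) tvector \<Rightarrow> bool"
  where
  "has_velocity A \<gamma> t I v \<longleftrightarrow> v \<in> tangent A (\<gamma> t) \<and>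
    (\<forall>c\<in>charts_at A (\<gamma> t). (\<forall>\<^sub>F s in at t within I. \<gamma> s \<in> fst c) \<and>
      ((snd c \<circ> \<gamma>) has_vector_derivative v c) (at t within I))"

text \<open>The tangent space at \<open>z\<close> of a submanifold \<open>T\<close> that may have a boundary: at a boundary point, a
  tangent vector or its negative is the initial velocity of a curve in \<open>T\<close>.\<close>

definition tangent_sub ::
    "('m, 'e::euclidean_space) chart set \<Rightarrow> 'm set \<Rightarrow> 'm \<Rightarrow> ('m, 'e) tvector set" where
  "tangent_sub A T z = {v. \<exists>\<gamma> \<delta>. 0 < \<delta> \<and> \<gamma> 0 = z \<and> (\<forall>t\<in>{0..\<delta>}. \<gamma> t \<in> T) \<and>
    (has_velocity A \<gamma> 0 {0..\<delta>} v \<or> has_velocity A \<gamma> 0 {0..\<delta>} (- v))}"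

definition riemannian_metric_on :: "('m, 'e::euclidean_space) chart set \<Rightarrow> 'm set \<Rightarrow>
    ('m \<Rightarrow> ('m, 'e) tvector \<Rightarrow> ('m, 'e) tvector \<Rightarrow> real) \<Rightarrow> bool" where
  "riemannian_metric_on A T g \<longleftrightarrow>
    (\<forall>q\<in>T.
      (\<forall>u\<in>tangent A q. \<forall>v\<in>tangent A q. g q u v = g q v u) \<and>
      (\<forall>u\<in>tangent A q. \<forall>v\<in>tangent A q. \<forall>w\<in>tangent A q. \<forall>a b.
        g q (a *\<^sub>R u + b *\<^sub>R v) w = a * g q u w + b * g q v w) \<and>
      (\<forall>u\<in>tangent A q. u \<noteq> 0 \<longrightarrow> 0 < g q u u)) \<and>
    (\<forall>c\<in>A. \<forall>i\<in>Basis. \<forall>j\<in>Basis. smooth_on (snd c ` (fst c \<inter> T))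
      (\<lambda>x. let q = chart_inv c x in g q (coord_vector A c q i) (coord_vector A c q j)))"

definition sharp :: "('m, 'e::euclidean_space) chart set \<Rightarrow>
    ('m \<Rightarrow> ('m, 'e) tvector \<Rightarrow> ('m, 'e) tvector \<Rightarrow> real) \<Rightarrow>
    'm \<Rightarrow> ('m, 'e) covector \<Rightarrow> ('m, 'e) tvector" where
  "sharp A g q \<xi> = (THE v. v \<in> tangent A q \<and> (\<forall>w\<in>tangent A q. g q v w = pairing A q \<xi> w))"

definition cometric :: "('m, 'e::euclidean_space) chart set \<Rightarrow>
    ('m \<Rightarrow> ('m, 'e) tvector \<Rightarrow> ('m, 'e) tvector \<Rightarrow> real) \<Rightarrow>
    'm \<Rightarrow> ('m, 'e) covector \<Rightarrow> ('m, 'e) covector \<Rightarrow> real" where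
  "cometric A g q \<xi> \<eta> = g q (sharp A g q \<xi>) (sharp A g q \<eta>)"

definition smooth_covector_field :: "('m, 'e::euclidean_space) chart set \<Rightarrow> 'm set \<Rightarrow>
    ('m \<Rightarrow> ('m, 'e) covector) \<Rightarrow> bool" where
  "smooth_covector_field A T \<theta> \<longleftrightarrow> (\<forall>q\<in>T. \<theta> q \<in> cotangent A q) \<and>
    (\<forall>c\<in>A. smooth_on (snd c ` (fst c \<inter> T)) (\<lambda>x. \<theta> (chart_inv c x) c))"

definition vector_subbundle :: "'m topology \<Rightarrow> ('m, 'e::euclidean_space) chart set \<Rightarrow> 'm set \<Rightarrow>
    ('m \<Rightarrow> ('m, 'e) covector set) \<Rightarrow> bool" where
  "vector_subbundle X A T C \<longleftrightarrow>
    (\<forall>q\<in>T. subspace (C q) \<and> C q \<subseteq> cotangent A q) \<and>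
    (\<forall>q\<in>T. \<exists>W k \<theta>. openin X W \<and> q \<in> W \<and>
      (\<forall>i<k. smooth_covector_field A (W \<inter> T) (\<theta> i)) \<and>
      (\<forall>x\<in>W \<inter> T. inj_on (\<lambda>i. \<theta> i x) {..<k::nat} \<and> independent ((\<lambda>i. \<theta> i x) ` {..<k}) \<and>
        C x = span ((\<lambda>i. \<theta> i x) ` {..<k})))"

type_synonym ('m, 'e) copoint = "'m \<times> ('m, 'e) covector"

definition cot_chart :: "('m, 'e::euclidean_space) chart set \<Rightarrow> ('m, 'e) chart \<Rightarrow>
    (('m, 'e) copoint, 'e \<times> 'e) chart" where
  "cot_chart A c = ({(q, \<xi>). q \<in> fst c \<and> \<xi> \<in> cotangent A q}, \<lambda>(q, \<xi>). (snd c q, \<xi> c))"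

definition cot_atlas :: "('m, 'e::euclidean_space) chart set \<Rightarrow>
    (('m, 'e) copoint, 'e \<times> 'e) chart set" where
  "cot_atlas A = cot_chart A ` A"

definition vertical_lift :: "('m, 'e::euclidean_space) chart set \<Rightarrow> ('m, 'e) copoint \<Rightarrow>
    ('m, 'e) covector \<Rightarrow> (('m, 'e) copoint, 'e \<times> 'e) tvector" where
  "vertical_lift A z \<rho> = (THE w. w \<in> tangent (cot_atlas A) z \<and>
    (\<forall>c\<in>charts_at A (fst z). w (cot_chart A c) = (0, \<rho> c)))"

datatype sign = Plus | Minus

fun opp :: "sign \<Rightarrow> sign" where
  "opp Plus = Minus"
| "opp Minus = Plus"

text \<open>\<open>inst S \<epsilon> = None\<close> means that there are no instantaneous constraints on the side \<open>\<epsilon>\<close>.\<close>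

record ('m, 'e) msystem =
  mtop :: "'m topology"
  atlas :: "('m, 'e) chart set"
  side :: "sign \<Rightarrow> 'm set"
  crit :: "'m set"
  metric :: "sign \<Rightarrow> 'm \<Rightarrow> ('m, 'e) tvector \<Rightarrow> ('m, 'e) tvector \<Rightarrow> real"
  pot :: "'m \<Rightarrow> real"
  constr :: "sign \<Rightarrow> 'm \<Rightarrow> ('m, 'e) covector set"
  inst :: "sign \<Rightarrow> ('m \<Rightarrow> ('m, 'e) covector set) option"

text \<open>The two sides are closed, and around a point of the hypersurface they are the two half spaces of
  some chart compatible with the atlas; so the hypersurface is their common boundary.\<close>

definition divided :: "('m, 'e::euclidean_space) msystem \<Rightarrow> bool" where
  "divided S \<longleftrightarrow>
    manifold_boundary (atlas S) = {} \<and>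
    closedin (mtop S) (side S Plus) \<and> closedin (mtop S) (side S Minus) \<and>
    side S Plus \<union> side S Minus = topspace (mtop S) \<and>
    side S Plus \<inter> side S Minus = crit S \<and>
    (\<forall>q\<in>crit S. \<exists>c. \<exists>i\<in>Basis. q \<in> fst c \<and> smooth_atlas (mtop S) (insert c (atlas S)) \<and>
      side S Plus \<inter> fst c = {x \<in> fst c. 0 \<le> snd c x \<bullet> i} \<and>
      side S Minus \<inter> fst c = {x \<in> fst c. snd c x \<bullet> i \<le> 0})"

definition with_boundary :: "('m, 'e::euclidean_space) msystem \<Rightarrow> bool" where
  "with_boundary S \<longleftrightarrow> side S Minus = {} \<and> side S Plus = topspace (mtop S) \<and>
    crit S = manifold_boundary (atlas S)"

definition mechanical_system :: "('m, 'e::euclidean_space) msystem \<Rightarrow> bool" where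
  "mechanical_system S \<longleftrightarrow>
    smooth_manifold (mtop S) (atlas S) \<and> (divided S \<or> with_boundary S) \<and>
    smooth_fun_on (atlas S) (topspace (mtop S)) (pot S) \<and>
    (\<forall>\<epsilon>. riemannian_metric_on (atlas S) (side S \<epsilon>) (metric S \<epsilon>) \<and>
      vector_subbundle (mtop S) (atlas S) (side S \<epsilon>) (constr S \<epsilon>) \<and>
      (\<forall>B. inst S \<epsilon> = Some B \<longrightarrow>
        vector_subbundle (mtop S) (atlas S) (crit S \<inter> side S \<epsilon>) B \<and>
        (\<forall>q\<in>crit S \<inter> side S \<epsilon>. B q \<subseteq> constr S \<epsilon> q)))"

text \<open>For a manifold with boundary the Hamiltonian is \<open>\<infinity>\<close> on the empty side, hence never smooth; the value
  \<open>\<infinity>\<close> of \<open>energy\<close> below excludes refractive steps to that side.\<close>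

definition smooth_hamiltonian :: "('m, 'e::euclidean_space) msystem \<Rightarrow> bool" where
  "smooth_hamiltonian S \<longleftrightarrow> divided S \<and>
    (\<exists>g. riemannian_metric_on (atlas S) (topspace (mtop S)) g \<and>
      (\<forall>\<epsilon>. \<forall>q\<in>side S \<epsilon>. \<forall>u\<in>tangent (atlas S) q. \<forall>v\<in>tangent (atlas S) q.
        metric S \<epsilon> q u v = g q u v))"

abbreviation cometr :: "('m, 'e::euclidean_space) msystem \<Rightarrow> sign \<Rightarrow> 'm \<Rightarrow>
    ('m, 'e) covector \<Rightarrow> ('m, 'e) covector \<Rightarrow> real" where
  "cometr S \<epsilon> \<equiv> cometric (atlas S) (metric S \<epsilon>)"

definition ham :: "('m, 'e::euclidean_space) msystem \<Rightarrow> sign \<Rightarrow> ('m, 'e) copoint \<Rightarrow> real" where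
  "ham S \<epsilon> z = (1/2) * cometr S \<epsilon> (fst z) (snd z) (snd z) + pot S (fst z)"

definition energy :: "('m, 'e::euclidean_space) msystem \<Rightarrow> sign \<Rightarrow> ('m, 'e) copoint \<Rightarrow> ereal" where
  "energy S \<epsilon> z = (if fst z \<in> side S \<epsilon> then ereal (ham S \<epsilon> z) else \<infinity>)"

text \<open>The fibre derivative \<open>\<partial>H/\<partial>p\<close>, a tangent vector by the duality of covectors and vectors.\<close>

definition legendre :: "('m, 'e::euclidean_space) msystem \<Rightarrow> sign \<Rightarrow> 'm \<Rightarrow>
    ('m, 'e) covector \<Rightarrow> ('m, 'e) tvector" where
  "legendre S \<epsilon> q \<xi> = (THE v. v \<in> tangent (atlas S) q \<and>
    (\<forall>\<eta>\<in>cotangent (atlas S) q.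
      ((\<lambda>s. ham S \<epsilon> (q, \<xi> + s *\<^sub>R \<eta>)) has_real_derivative pairing (atlas S) q \<eta> v) (at 0)))"

definition velocities :: "('m, 'e::euclidean_space) msystem \<Rightarrow> sign \<Rightarrow> 'm \<Rightarrow> ('m, 'e) tvector set" where
  "velocities S \<epsilon> q = legendre S \<epsilon> q ` constr S \<epsilon> q"

abbreviation crit_tangent :: "('m, 'e::euclidean_space) msystem \<Rightarrow> 'm \<Rightarrow> ('m, 'e) tvector set" where
  "crit_tangent S q \<equiv> tangent_sub (atlas S) (crit S) q"

definition regular :: "('m, 'e::euclidean_space) msystem \<Rightarrow> bool" where
  "regular S \<longleftrightarrow>
    (\<forall>\<epsilon>. \<forall>q\<in>crit S \<inter> side S \<epsilon>. \<not> velocities S \<epsilon> q \<subseteq> crit_tangent S q)"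

definition cbundle :: "('m, 'e::euclidean_space) msystem \<Rightarrow> sign \<Rightarrow> ('m, 'e) copoint set" where
  "cbundle S \<epsilon> = {(q, \<xi>). q \<in> side S \<epsilon> \<and> \<xi> \<in> constr S \<epsilon> q}"

definition cboundary :: "('m, 'e::euclidean_space) msystem \<Rightarrow> sign \<Rightarrow> ('m, 'e) copoint set" where
  "cboundary S \<epsilon> = {z \<in> cbundle S \<epsilon>. fst z \<in> crit S}"

text \<open>Hamilton's equations in every canonical chart: if the free field has components \<open>(u, p)\<close>, then the
  differential of the Hamiltonian is \<open>(x, y) \<mapsto> y \<bullet> u - x \<bullet> p\<close>.\<close>

definition free_field :: "('m, 'e::euclidean_space) msystem \<Rightarrow> sign \<Rightarrow> ('m, 'e) copoint \<Rightarrow>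
    (('m, 'e) copoint, 'e \<times> 'e) tvector" where
  "free_field S \<epsilon> z = (THE w. w \<in> tangent (cot_atlas (atlas S)) z \<and>
    (\<forall>c\<in>charts_at (cot_atlas (atlas S)) z.
      ((ham S \<epsilon> \<circ> chart_inv c) has_derivative (\<lambda>(x, y). y \<bullet> fst (w c) - x \<bullet> snd (w c)))
        (at (snd c z) within snd c ` {z' \<in> fst c. fst z' \<in> side S \<epsilon>})))"

definition constrained_field :: "('m, 'e::euclidean_space) msystem \<Rightarrow> sign \<Rightarrow> ('m, 'e) copoint \<Rightarrow>
    (('m, 'e) copoint, 'e \<times> 'e) tvector" where
  "constrained_field S \<epsilon> z = (THE w. w \<in> tangent_sub (cot_atlas (atlas S)) (cbundle S \<epsilon>) z \<and>
    (\<exists>\<rho>\<in>annihilator (atlas S) (fst z) (velocities S \<epsilon> (fst z)).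
      w = free_field S \<epsilon> z + vertical_lift (atlas S) z \<rho>))"

definition trajectory :: "('m, 'e::euclidean_space) msystem \<Rightarrow> sign \<Rightarrow> real \<Rightarrow>
    (real \<Rightarrow> ('m, 'e) copoint) \<Rightarrow> real \<Rightarrow> real \<Rightarrow> bool" where
  "trajectory S \<epsilon> \<sigma> \<beta> a b \<longleftrightarrow> a < b \<and> (\<forall>t\<in>{a..b}. \<beta> t \<in> cbundle S \<epsilon> \<and>
    has_velocity (cot_atlas (atlas S)) \<beta> t {a..b} (\<sigma> *\<^sub>R constrained_field S \<epsilon> (\<beta> t)))"

definition in_point :: "('m, 'e::euclidean_space) msystem \<Rightarrow> sign \<Rightarrow> ('m, 'e) copoint \<Rightarrow> bool" where
  "in_point S \<epsilon> z \<longleftrightarrow> z \<in> cboundary S \<epsilon> \<and>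
    (\<exists>\<beta> a. trajectory S \<epsilon> 1 \<beta> 0 a \<and> \<beta> 0 = z \<and> (\<forall>t\<in>{0<..a}. \<beta> t \<notin> cboundary S \<epsilon>))"

definition out_point :: "('m, 'e::euclidean_space) msystem \<Rightarrow> sign \<Rightarrow> ('m, 'e) copoint \<Rightarrow> bool" where
  "out_point S \<epsilon> z \<longleftrightarrow> z \<in> cboundary S \<epsilon> \<and>
    (\<exists>\<beta> a. trajectory S \<epsilon> (-1) \<beta> 0 a \<and> \<beta> 0 = z \<and> (\<forall>t\<in>{0<..a}. \<beta> t \<notin> cboundary S \<epsilon>))"

definition trapping_point :: "('m, 'e::euclidean_space) msystem \<Rightarrow> sign \<Rightarrow> ('m, 'e) copoint \<Rightarrow> bool" where
  "trapping_point S \<epsilon> z \<longleftrightarrow>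
    (\<exists>\<beta> a b. trajectory S \<epsilon> 1 \<beta> a b \<and> z \<in> \<beta> ` {a..b} \<and> \<beta> ` {a..b} \<subseteq> cboundary S \<epsilon>)"

definition tr :: "('m, 'e::euclidean_space) msystem \<Rightarrow> sign \<Rightarrow> ('m \<Rightarrow> ('m, 'e) covector set) \<Rightarrow>
    'm \<Rightarrow> ('m, 'e) covector set" where
  "tr S \<epsilon> E q = {\<xi> \<in> E q. legendre S \<epsilon> q \<xi> \<in> crit_tangent S q}"

definition impact_constr :: "('m, 'e::euclidean_space) msystem \<Rightarrow> sign \<Rightarrow>
    'm \<Rightarrow> ('m, 'e) covector set" where
  "impact_constr S \<epsilon> = (case inst S \<epsilon> of None \<Rightarrow> constr S \<epsilon> | Some B \<Rightarrow> B)"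

definition focusing_point :: "('m, 'e::euclidean_space) msystem \<Rightarrow> sign \<Rightarrow>
    ('m \<Rightarrow> ('m, 'e) covector set) \<Rightarrow> ('m, 'e) copoint \<Rightarrow> ('m, 'e) copoint \<Rightarrow> bool" where
  "focusing_point S \<epsilon> E z u \<longleftrightarrow> fst u = fst z \<and> snd u \<in> E (fst z) \<and>
    (\<forall>\<eta>\<in>E (fst z). cometr S \<epsilon> (fst z) (snd z - snd u) \<eta> = 0)"

definition characteristic :: "('m, 'e::euclidean_space) msystem \<Rightarrow> sign \<Rightarrow>
    ('m, 'e) copoint \<Rightarrow> ('m, 'e) copoint set" where
  "characteristic S \<epsilon> y = {(q, \<xi> + \<eta>) |q \<xi> \<eta>. y = (q, \<xi>) \<and> \<eta> \<in> constr S \<epsilon> q \<and>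
    \<eta> \<in> annihilator (atlas S) q (velocities S \<epsilon> q \<inter> crit_tangent S q)}"

text \<open>The argument \<open>E\<close> is the family of constraints used for focusing: the impact constraints for
  reflective and refractive steps, their \<open>tr\<close> part for the falling steps.\<close>

definition reflective_step :: "('m, 'e::euclidean_space) msystem \<Rightarrow>
    (sign \<Rightarrow> 'm \<Rightarrow> ('m, 'e) covector set) \<Rightarrow>
    ('m, 'e) copoint \<Rightarrow> sign \<Rightarrow> ('m, 'e) copoint \<Rightarrow> sign \<Rightarrow> bool" where
  "reflective_step S E y \<epsilon> u \<epsilon>' \<longleftrightarrow> \<epsilon>' = \<epsilon> \<and>
    (\<exists>z\<in>characteristic S \<epsilon> y. energy S \<epsilon> z = energy S \<epsilon> y \<and> focusing_point S \<epsilon> (E \<epsilon>) z u)"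

definition refractive_step :: "('m, 'e::euclidean_space) msystem \<Rightarrow>
    (sign \<Rightarrow> 'm \<Rightarrow> ('m, 'e) covector set) \<Rightarrow>
    ('m, 'e) copoint \<Rightarrow> sign \<Rightarrow> ('m, 'e) copoint \<Rightarrow> sign \<Rightarrow> bool" where
  "refractive_step S E y \<epsilon> u \<epsilon>' \<longleftrightarrow> \<epsilon>' = opp \<epsilon> \<and>
    (\<exists>z\<in>characteristic S \<epsilon> y. energy S (opp \<epsilon>) z = energy S \<epsilon> y \<and>
      focusing_point S (opp \<epsilon>) (E (opp \<epsilon>)) z u)"

definition smooth_step :: "('m, 'e::euclidean_space) msystem \<Rightarrow>
    (sign \<Rightarrow> 'm \<Rightarrow> ('m, 'e) covector set) \<Rightarrow>
    ('m, 'e) copoint \<Rightarrow> sign \<Rightarrow> ('m, 'e) copoint \<Rightarrow> sign \<Rightarrow> bool" where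
  "smooth_step S E y \<epsilon> u \<epsilon>' \<longleftrightarrow> \<epsilon>' = opp \<epsilon> \<and> focusing_point S (opp \<epsilon>) (E (opp \<epsilon>)) y u"

definition impact_step :: "('m, 'e::euclidean_space) msystem \<Rightarrow>
    (sign \<Rightarrow> 'm \<Rightarrow> ('m, 'e) covector set) \<Rightarrow>
    ('m, 'e) copoint \<Rightarrow> sign \<Rightarrow> ('m, 'e) copoint \<Rightarrow> sign \<Rightarrow> bool" where
  "impact_step S E y \<epsilon> u \<epsilon>' \<longleftrightarrow>
    (if smooth_hamiltonian S then smooth_step S E y \<epsilon> u \<epsilon>'
     else reflective_step S E y \<epsilon> u \<epsilon>' \<or> refractive_step S E y \<epsilon> u \<epsilon>')"

definition admissible :: "('m, 'e::euclidean_space) msystem \<Rightarrow> nat \<Rightarrow>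
    (nat \<Rightarrow> ('m, 'e) copoint) \<Rightarrow> (nat \<Rightarrow> sign) \<Rightarrow> bool" where
  "admissible S k y \<epsilon> \<longleftrightarrow>
    (\<forall>i<k. out_point S (\<epsilon> i) (y i) \<and>
      impact_step S (impact_constr S) (y i) (\<epsilon> i) (y (Suc i)) (\<epsilon> (Suc i))) \<and>
    (in_point S (\<epsilon> k) (y k) \<or> trapping_point S (\<epsilon> k) (y k))"

datatype impact_mode = Elastic | Inelastic

fun decisive :: "('m, 'e::euclidean_space) msystem \<Rightarrow> impact_mode \<Rightarrow>
    ('m, 'e) copoint \<Rightarrow> sign \<Rightarrow> ('m, 'e) copoint \<Rightarrow> sign \<Rightarrow> bool" where
  "decisive S Elastic y \<epsilon> y' \<epsilon>' \<longleftrightarrow>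
    (\<exists>k ys \<epsilon>s. admissible S k ys \<epsilon>s \<and> ys 0 = y \<and> \<epsilon>s 0 = \<epsilon> \<and> ys k = y' \<and> \<epsilon>s k = \<epsilon>')"
| "decisive S Inelastic y \<epsilon> y' \<epsilon>' \<longleftrightarrow>
    impact_step S (\<lambda>\<delta>. tr S \<delta> (impact_constr S \<delta>)) y \<epsilon> y' \<epsilon>'"

end

theory Submission
  imports Defs
begin

text \<open>
  Every move that leads to a decisive point ends with an orthogonal projection. Up to that projection
  the energy is preserved: a reflective or refractive step first moves along the characteristic to a
  point of the same energy, and a step for a smooth Hamiltonian changes sides where the two co-metrics
  agree. Projecting a covector \<open>p\<close> orthogonally to \<open>u\<close> replaces \<open>p = (p - u) + u\<close> by one of two
  orthogonal summands, so by Pythagoras the kinetic energy drops by that of \<open>p - u\<close>, while the base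
  point and hence the potential stay the same (\<open>focusing_point_energy_le\<close>). An elastic
  transition composes finitely many such moves; an inelastic one is a single move, and its projection
  onto a smaller space is covered by the same argument.

  Pythagoras requires the residue \<open>p - u\<close> to be orthogonal to \<open>u\<close>, which
  lies in the space projected onto, and the co-metric to be a symmetric, positive semidefinite
  bilinear form. For the latter, the covector-to-vector map of the metric has to be shown to be well
  defined, as it is given by a definite description. This is the Riesz representation of functionals
  on a tangent space (\<open>sharp_characterization\<close>), which requires tangent spaces to be
  finite-dimensional vector spaces: transition derivatives are linear, and a tangent vector is
  determined by its components in a single chart.
\<close>

section \<open>Riesz representation on finitely spanned spaces\<close>

locale pos_def_form =
  fixes V :: "'a::real_vector set" and B :: "'a \<Rightarrow> 'a \<Rightarrow> real"
  assumes subspace_V: "subspace V"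
    and sym: "\<lbrakk>u \<in> V; v \<in> V\<rbrakk> \<Longrightarrow> B u v = B v u"
    and lin: "\<lbrakk>u \<in> V; v \<in> V; w \<in> V\<rbrakk> \<Longrightarrow> B (a *\<^sub>R u + b *\<^sub>R v) w = a * B u w + b * B v w"
    and pos: "\<lbrakk>u \<in> V; u \<noteq> 0\<rbrakk> \<Longrightarrow> 0 < B u u"
begin

lemma lin_right:
  "\<lbrakk>u \<in> V; v \<in> V; w \<in> V\<rbrakk> \<Longrightarrow> B w (a *\<^sub>R u + b *\<^sub>R v) = a * B w u + b * B w v"
  using lin[of u v w a b] sym subspace_V by (simp add: subspace_add subspace_scale)

lemma diff_left: "\<lbrakk>u \<in> V; v \<in> V; w \<in> V\<rbrakk> \<Longrightarrow> B (u - v) w = B u w - B v w"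
  using lin[of u v w 1 "-1"] by simp

lemma nonneg: "u \<in> V \<Longrightarrow> 0 \<le> B u u"
  using pos[of u] lin[of u u u 0 0] by (cases "u = 0") auto

text \<open>Gram--Schmidt, one spanning vector at a time: a new vector \<open>a\<close> is made orthogonal to the span
  of the previous ones by subtracting the representative of \<open>B a\<close> there, which the induction
  hypothesis provides.\<close>

lemma riesz_exists_span:
  assumes "finite F" "F \<subseteq> V"
    and "\<And>u v a b. \<lbrakk>u \<in> V; v \<in> V\<rbrakk> \<Longrightarrow> \<phi> (a *\<^sub>R u + b *\<^sub>R v) = a * \<phi> u + b * \<phi> v"
  shows "\<exists>v\<in>span F. \<forall>w\<in>span F. B v w = \<phi> w"
  using assms
proof (induction F arbitrary: \<phi> rule: finite_induct)
  case empty
  have "B 0 0 = 0" "\<phi> 0 = 0"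
    using lin[of 0 0 0 0 0] empty.prems(2)[of 0 0 0 0] subspace_0[OF subspace_V] by simp_all
  then show ?case by simp
next
  case (insert a F)
  have aV: "a \<in> V" and FV: "span F \<subseteq> V"
    using insert.prems(1) span_minimal[OF _ subspace_V] by auto
  obtain v0 where v0: "v0 \<in> span F" "\<And>w. w \<in> span F \<Longrightarrow> B v0 w = \<phi> w"
    using insert.IH[of \<phi>] insert.prems by auto
  obtain p where p: "p \<in> span F" "\<And>w. w \<in> span F \<Longrightarrow> B p w = B a w"
    using insert.IH[of "B a"] insert.prems(1) lin_right[OF _ _ aV] by auto
  define n where "n = a - p"
  have nV: "n \<in> V" unfolding n_def using aV p(1) FV subspace_diff[OF subspace_V] by blast
  have orth: "B n w = 0" if "w \<in> span F" for w
    unfolding n_def using diff_left[of a p w] aV FV p that by auto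
  \<comment> \<open>If \<open>n = 0\<close>, the coefficient below is \<open>0\<close> because division by \<open>0\<close> yields \<open>0\<close>.\<close>
  define v where "v = v0 + (\<phi> n / B n n) *\<^sub>R n"
  have n_span: "n \<in> span (insert a F)"
    unfolding n_def using p(1) span_mono[of F "insert a F"]
    by (meson insertI1 span_base span_diff subset_insertI subsetD)
  have "v \<in> span (insert a F)"
    unfolding v_def using n_span v0(1) span_mono[of F "insert a F"]
    by (meson span_add span_scale subset_insertI subsetD)
  moreover have "B v w = \<phi> w" if w: "w \<in> span (insert a F)" for w
  proof -
    obtain k where k: "w - k *\<^sub>R a \<in> span F"
      using w span_breakdown_eq by blast
    define w0 where "w0 = w - k *\<^sub>R n"
    have "w0 = (w - k *\<^sub>R a) + k *\<^sub>R p"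
      by (simp add: w0_def n_def algebra_simps)
    then have w0: "w0 \<in> span F"
      using k p(1) by (simp add: span_add span_scale)
    have in_V: "v0 \<in> V" "w0 \<in> V" using v0(1) w0 FV by auto
    have w_eq: "w = 1 *\<^sub>R w0 + k *\<^sub>R n" by (simp add: w0_def)
    have "B v w = B v w0 + k * B v n"
      using lin_right[of w0 n v 1 k] in_V nV subspace_V
      by (simp add: w_eq v_def subspace_add subspace_scale)
    also have "B v w0 = \<phi> w0"
      using lin[of v0 n w0 1 "\<phi> n / B n n"] in_V nV orth w0 v0(2) by (simp add: v_def)
    also have "B v n = (\<phi> n / B n n) * B n n"
      using lin[of v0 n n 1 "\<phi> n / B n n"] in_V nV orth v0(1) sym[of v0 n] by (simp add: v_def)
    also have "(\<phi> n / B n n) * B n n = \<phi> n"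
      using pos[OF nV] insert.prems(2)[of 0 0 0 0] subspace_0[OF subspace_V]
      by (cases "n = 0") auto
    also have "\<phi> w0 + k * \<phi> n = \<phi> w"
      using insert.prems(2)[of w0 n 1 k] in_V nV by (simp add: w_eq)
    finally show ?thesis .
  qed
  ultimately show ?case by blast
qed

lemma riesz_unique_exists:
  assumes "finite F" "V = span F"
    and "\<And>u v a b. \<lbrakk>u \<in> V; v \<in> V\<rbrakk> \<Longrightarrow> \<phi> (a *\<^sub>R u + b *\<^sub>R v) = a * \<phi> u + b * \<phi> v"
  shows "\<exists>!v. v \<in> V \<and> (\<forall>w\<in>V. B v w = \<phi> w)"
proof -
  have "F \<subseteq> V" using assms(2) span_superset by blast
  then obtain v where "v \<in> V" "\<forall>w\<in>V. B v w = \<phi> w"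
    using riesz_exists_span[of F \<phi>] assms by auto
  moreover have "v' = v" if "v' \<in> V" "\<forall>w\<in>V. B v' w = \<phi> w" "v \<in> V" "\<forall>w\<in>V. B v w = \<phi> w" for v v'
  proof -
    have "v' - v \<in> V" using that subspace_diff[OF subspace_V] by blast
    then have "B (v' - v) (v' - v) = 0" using diff_left that by simp
    with \<open>v' - v \<in> V\<close> show ?thesis using pos[of "v' - v"] by auto
  qed
  ultimately show ?thesis by blast
qed

end

section \<open>Tangent spaces and the evaluation of covectors\<close>

lemma smooth_on_imp_differentiable:
  assumes "smooth_on T f" "x \<in> T"
  shows "f differentiable (at x within T)"
proof -
  obtain U F where U: "open U" "x \<in> U" "\<forall>k. Ck_on k F U" "\<forall>y\<in>T \<inter> U. F y = f y"
    using assms unfolding smooth_on_def by blast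
  from U(3) have "Ck_on (Suc 0) F U" by blast
  then obtain D where "(F has_derivative D) (at x)" using U(2) by auto
  then have F: "(F has_derivative D) (at x within T)" by (rule has_derivative_at_withinI)
  obtain e where "e > 0" "ball x e \<subseteq> U" using U(1,2) open_contains_ball by blast
  then have "(f has_derivative D) (at x within T)"
    using has_derivative_transform_within[OF F, of e f] assms(2) U(4)
    by (auto simp: dist_commute subset_iff)
  then show ?thesis by (auto simp: differentiable_def)
qed

lemma linear_dtrans:
  assumes "smooth_atlas X A" "c \<in> charts_at A q" "d \<in> charts_at A q"
  shows "linear (dtrans c d q)"
proof -
  have "smooth_on (snd c ` (fst c \<inter> fst d)) (snd d \<circ> chart_inv c)"
    using assms unfolding smooth_atlas_def charts_at_def by blast
  moreover have "snd c q \<in> snd c ` (fst c \<inter> fst d)"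
    using assms(2,3) by (auto simp: charts_at_def)
  ultimately show ?thesis
    unfolding dtrans_def
    using smooth_on_imp_differentiable frechet_derivative_works has_derivative_linear by blast
qed

lemma subspace_tangent:
  assumes "smooth_atlas X A"
  shows "subspace (tangent A q)"
proof (rule subspaceI)
  show "0 \<in> tangent A q"
    unfolding tangent_def using linear_0[OF linear_dtrans[OF assms]] by simp
next
  fix u v assume "u \<in> tangent A q" "v \<in> tangent A q"
  then show "u + v \<in> tangent A q"
    unfolding tangent_def mem_Collect_eq plus_fun_apply
    by (metis add_0 linear_add[OF linear_dtrans[OF assms]])
next
  fix a u assume "u \<in> tangent A q"
  then show "a *\<^sub>R u \<in> tangent A q"
    unfolding tangent_def mem_Collect_eq scaleR_fun_def
    by (metis scaleR_zero_right linear_scale[OF linear_dtrans[OF assms]])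
qed

text \<open>Evaluation in one chart embeds the tangent space linearly into the coordinate space, since the
  components in the other charts are determined by the transformation rule.\<close>

lemma tangent_finite_span:
  assumes atlas: "smooth_atlas X (A :: ('m, 'e::euclidean_space) chart set)" and "charts_at A q \<noteq> {}"
  obtains F where "finite F" "tangent A q = span F"
proof -
  obtain c where c: "c \<in> charts_at A q" using assms(2) by blast
  obtain F where F: "F \<subseteq> tangent A q" "independent F" "tangent A q \<subseteq> span F"
    using basis_exists[of "tangent A q"] by metis
  have span: "tangent A q = span F"
    using F span_minimal[OF F(1) subspace_tangent[OF atlas]] by blast
  have lin: "linear (\<lambda>v :: ('m, 'e) tvector. v c)"
    by (rule linearI) (simp_all add: scaleR_fun_def)
  have "v = w" if "v \<in> tangent A q" "w \<in> tangent A q" "v c = w c" for v w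
  proof
    fix d
    show "v d = w d"
    proof (cases "d \<in> charts_at A q")
      case True
      then have "v d = dtrans c d q (v c)" "w d = dtrans c d q (w c)"
        using that(1,2) c unfolding tangent_def by blast+
      then show ?thesis using that(3) by simp
    next
      case False
      then have "v d = 0" "w d = 0" using that(1,2) unfolding tangent_def by blast+
      then show ?thesis by simp
    qed
  qed
  then have inj: "inj_on (\<lambda>v. v c) (tangent A q)" by (auto intro: inj_onI)
  then have "independent ((\<lambda>v. v c) ` F)"
    using linear_independent_injective_image[OF lin F(2)] span by simp
  then have "finite ((\<lambda>v. v c) ` F)" by (rule independent_imp_finite)
  then have "finite F" using inj_on_subset[OF inj F(1)] finite_imageD by blast
  with span show ?thesis using that by blast
qed

lemma pairing_linear_right:
  "pairing A q \<xi> (a *\<^sub>R u + b *\<^sub>R v) = a * pairing A q \<xi> u + b * pairing A q \<xi> v"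
  by (simp add: pairing_def Let_def scaleR_fun_def inner_right_distrib)

lemma pairing_add_left: "pairing A q (\<xi> + \<eta>) v = pairing A q \<xi> v + pairing A q \<eta> v"
  by (simp add: pairing_def Let_def inner_left_distrib)

section \<open>The co-metric\<close>

locale metric_point =
  fixes X :: "'m topology" and A :: "('m, 'e::euclidean_space) chart set"
    and T :: "'m set" and g and q
  assumes atlas: "smooth_atlas X A" and q: "q \<in> T" "q \<in> topspace X"
    and metric: "riemannian_metric_on A T g"
begin

sublocale pos_def_form "tangent A q" "g q"
  using metric q(1) subspace_tangent[OF atlas]
  by unfold_locales (auto simp: riemannian_metric_on_def)

lemma sharp_characterization:
  "sharp A g q \<xi> \<in> tangent A q \<and> (\<forall>w\<in>tangent A q. g q (sharp A g q \<xi>) w = pairing A q \<xi> w)"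
proof -
  have "charts_at A q \<noteq> {}"
    using atlas q(2) unfolding smooth_atlas_def charts_at_def by blast
  then obtain F where "finite F" "tangent A q = span F"
    using tangent_finite_span[OF atlas] by blast
  then have "\<exists>!v. v \<in> tangent A q \<and> (\<forall>w\<in>tangent A q. g q v w = pairing A q \<xi> w)"
    by (rule riesz_unique_exists) (rule pairing_linear_right)
  then show ?thesis unfolding sharp_def by (rule theI')
qed

lemma cometric_eq_pairing: "cometric A g q \<xi> \<eta> = pairing A q \<xi> (sharp A g q \<eta>)"
  using sharp_characterization by (simp add: cometric_def)

lemma cometric_sym: "cometric A g q \<xi> \<eta> = cometric A g q \<eta> \<xi>"
  using sharp_characterization by (simp add: cometric_def sym)

lemma cometric_add_left:
  "cometric A g q (\<xi> + \<eta>) \<theta> = cometric A g q \<xi> \<theta> + cometric A g q \<eta> \<theta>"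
  by (simp add: cometric_eq_pairing pairing_add_left)

lemma cometric_nonneg: "0 \<le> cometric A g q \<xi> \<xi>"
  unfolding cometric_def using sharp_characterization nonneg by blast

text \<open>The squared length of a sum of orthogonal covectors is the sum of their squared lengths, and the
  discarded summand contributes a nonnegative amount.\<close>

lemma cometric_orthogonal_part_le:
  assumes "cometric A g q (\<xi> - \<upsilon>) \<upsilon> = 0"
  shows "cometric A g q \<upsilon> \<upsilon> \<le> cometric A g q \<xi> \<xi>"
proof -
  define \<rho> where "\<rho> = \<xi> - \<upsilon>"
  have \<xi>: "\<xi> = \<rho> + \<upsilon>" by (simp add: \<rho>_def)
  have "cometric A g q \<xi> \<xi> = cometric A g q \<rho> \<rho> + 2 * cometric A g q \<rho> \<upsilon> + cometric A g q \<upsilon> \<upsilon>"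
    unfolding \<xi> using cometric_sym[of _ "\<rho> + \<upsilon>"] cometric_sym[of \<upsilon> \<rho>] by (simp add: cometric_add_left)
  then show ?thesis using assms cometric_nonneg[of \<rho>] by (simp add: \<rho>_def)
qed

text \<open>A metric matters only through its values on tangent vectors, so two metrics that agree there
  induce the same co-metric.\<close>

lemma cometric_cong:
  assumes "\<And>u v. \<lbrakk>u \<in> tangent A q; v \<in> tangent A q\<rbrakk> \<Longrightarrow> g q u v = g' q u v"
  shows "cometric A g q \<xi> \<eta> = cometric A g' q \<xi> \<eta>"
proof -
  have "sharp A g q = sharp A g' q"
    unfolding sharp_def using assms by (intro ext arg_cong[of _ _ The]) auto
  then show ?thesis
    using assms sharp_characterization by (simp add: cometric_def)
qed

end

section \<open>Energy loss of a single move\<close>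

lemma mechanical_system_metric_point:
  assumes "mechanical_system S" "q \<in> side S \<epsilon>"
  shows "metric_point (mtop S) (atlas S) (side S \<epsilon>) (metric S \<epsilon>) q"
proof
  show "smooth_atlas (mtop S) (atlas S)"
    using assms(1) by (simp add: mechanical_system_def smooth_manifold_def)
  show "q \<in> topspace (mtop S)"
    using assms by (cases \<epsilon>) (auto simp: mechanical_system_def divided_def with_boundary_def)
qed (use assms in \<open>auto simp: mechanical_system_def\<close>)

lemma focusing_point_energy_le:
  assumes "mechanical_system S" "fst z \<in> side S \<epsilon>" "focusing_point S \<epsilon> E z u"
  shows "energy S \<epsilon> u \<le> energy S \<epsilon> z"
proof -
  interpret metric_point "mtop S" "atlas S" "side S \<epsilon>" "metric S \<epsilon>" "fst z"
    by (rule mechanical_system_metric_point[OF assms(1,2)])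
  have "cometr S \<epsilon> (fst z) (snd z - snd u) (snd u) = 0" "fst u = fst z"
    using assms(3) by (auto simp: focusing_point_def)
  then show ?thesis
    using cometric_orthogonal_part_le assms(2) by (simp add: energy_def ham_def)
qed

lemma smooth_hamiltonian_energy_eq:
  assumes "mechanical_system S" "smooth_hamiltonian S" "fst z \<in> crit S"
  shows "energy S \<epsilon> z = energy S \<delta> z"
proof -
  have on_side: "fst z \<in> side S \<epsilon>" for \<epsilon>
    using assms(2,3) by (cases \<epsilon>) (auto simp: smooth_hamiltonian_def divided_def)
  interpret metric_point "mtop S" "atlas S" "side S \<epsilon>" "metric S \<epsilon>" "fst z"
    by (rule mechanical_system_metric_point[OF assms(1) on_side])
  have "metric S \<epsilon> (fst z) u v = metric S \<delta> (fst z) u v"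
    if "u \<in> tangent (atlas S) (fst z)" "v \<in> tangent (atlas S) (fst z)" for u v
    using assms(2) that on_side unfolding smooth_hamiltonian_def by metis
  then have "cometr S \<epsilon> (fst z) \<xi> \<eta> = cometr S \<delta> (fst z) \<xi> \<eta>" for \<xi> \<eta>
    by (rule cometric_cong)
  then show ?thesis using on_side by (simp add: energy_def ham_def)
qed

text \<open>In a refractive step the intermediate point lies on the opposite side because its energy there
  equals the finite energy of the initial point.\<close>

lemma impact_step_energy_le:
  assumes "mechanical_system S" "y \<in> cboundary S \<epsilon>" "impact_step S E y \<epsilon> u \<epsilon>'"
  shows "energy S \<epsilon>' u \<le> energy S \<epsilon> y"
proof -
  have y: "fst y \<in> crit S" "fst y \<in> side S \<epsilon>"
    using assms(2) by (auto simp: cboundary_def cbundle_def)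
  have step: "energy S \<epsilon>' u \<le> energy S \<epsilon> y"
    if "energy S \<epsilon>' z = energy S \<epsilon> y" "focusing_point S \<epsilon>' (E \<epsilon>') z u" for z
  proof -
    have "fst z \<in> side S \<epsilon>'"
      using that(1) y(2) by (auto simp: energy_def split: if_splits)
    from focusing_point_energy_le[OF assms(1) this that(2)] show ?thesis
      using that(1) by simp
  qed
  show ?thesis
  proof (cases "smooth_hamiltonian S")
    case True
    then show ?thesis
      using assms(3) step[of y] smooth_hamiltonian_energy_eq[OF assms(1) True y(1)]
      by (simp add: impact_step_def smooth_step_def)
  next
    case False
    then show ?thesis
      using assms(3) step by (auto simp: impact_step_def reflective_step_def refractive_step_def)
  qed
qed

theorem theorem1:
  fixes S :: "('m, 'e::euclidean_space) msystem"
    and y y' :: "('m, 'e) copoint"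
    and \<epsilon> \<epsilon>' :: sign
    and mode :: impact_mode
  assumes "mechanical_system S"
    and "regular S"
    and "out_point S \<epsilon> y"
    and "decisive S mode y \<epsilon> y' \<epsilon>'"
  shows "energy S \<epsilon>' y' \<le> energy S \<epsilon> y"
proof (cases mode)
  case Elastic
  then obtain k ys \<epsilon>s where adm: "admissible S k ys \<epsilon>s"
    and ends: "ys 0 = y" "\<epsilon>s 0 = \<epsilon>" "ys k = y'" "\<epsilon>s k = \<epsilon>'"
    using assms(4) by auto
  have "i \<le> k \<Longrightarrow> energy S (\<epsilon>s i) (ys i) \<le> energy S \<epsilon> y" for i
  proof (induction i)
    case 0
    then show ?case by (simp add: ends)
  next
    case (Suc i)
    then have "ys i \<in> cboundary S (\<epsilon>s i)"
      "impact_step S (impact_constr S) (ys i) (\<epsilon>s i) (ys (Suc i)) (\<epsilon>s (Suc i))"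
      using adm by (auto simp: admissible_def out_point_def)
    from impact_step_energy_le[OF assms(1) this] Suc show ?case by simp
  qed
  from this[of k] show ?thesis by (simp add: ends)
next
  case Inelastic
  then show ?thesis
    using assms(3,4) impact_step_energy_le[OF assms(1)] by (auto simp: out_point_def)
qed

end
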